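(* For every $\Delta\in\mathbb Z$ with $\Delta\ge1$, and every $\epsilon\in(0,1)$, there is an instance of (IQP), in some number $n$ of variables, with subdeterminant $\Delta$ and $k=n$, for which $\delta^*_\epsilon>n\Delta$, where $$\delta^*_\epsilon:=\min\{\|x^c-x^*\|_\infty : x^*\ \epsilon\text{-approximate solution to (IQP)},\ x^c \text{ optimal solution to (QP)}\}$$ and (QP) is the continuous problem corresponding to (IQP).
   Context: An instance of (IQP) is a problem $\min\{f(x): Ax\le b,\ x\in\mathbb Z^n\}$ with $f(x)=\sum_{i=1}^k -q_i x_i^2+h^{\mathsf T}x$, where $0\le k\le n$, $q_i>0$ for $i=1,\dots,k$, $A$ is an integer matrix with $n$ columns, and $q_i$, $h$, $b$ are real. The corresponding (QP) is $\min\{f(x): Ax\le b,\ x\in\mathbb R^n\}$. The instance has subdeterminant $\Delta$ if the maximum of the absolute values of the subdeterminants (determinants of square submatrices) of $A$ is $\Delta$. $\epsilon$-approximate solution: for a problem $\min\{f(x): x\in S\}$, $S\subseteq\mathbb R^n$, having an optimal solution $x^{\mathrm{opt}}$, let $f_{\max}$ be the maximum value of $f$ on $S$. For $\epsilon\in[0,1]$, a feasible point $x^*\in S$ is an $\epsilon$-approximate solution if $f(x^* )-f(x^{\mathrm{opt}})\le\epsilon\,(f_{\max}-f(x^{\mathrm{opt}}))$. If $f$ is unbounded above on $S$, every feasible point is an $\epsilon$-approximate solution for every $\epsilon>0$. The definition of $\delta^*_\epsilon$ is for instances in which both (IQP) and (QP) have an optimal solution (which is part of what is asserted to exist). *)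

theory Defs
  imports Complex_Main "Jordan_Normal_Form.Determinant" "Jordan_Normal_Form.DL_Submatrix"
begin

(* The index sets are nonempty, so the 0 x 0 matrix (determinant 1) does not count. *)
definition subdeterminants :: "int mat \<Rightarrow> int set" where
  "subdeterminants A = {det (submatrix A I J) | I J.
     I \<subseteq> {..<dim_row A} \<and> J \<subseteq> {..<dim_col A} \<and> card I = card J \<and> I \<noteq> {}}"

definition has_subdeterminant :: "int mat \<Rightarrow> int \<Rightarrow> bool" where
  "has_subdeterminant A \<Delta> \<longleftrightarrow>
     \<Delta> \<in> abs ` subdeterminants A \<and> (\<forall>d \<in> subdeterminants A. \<bar>d\<bar> \<le> \<Delta>)"

(* The 0 only fixes the value at the vector of dimension 0. *)
definition linf_norm :: "real vec \<Rightarrow> real" where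
  "linf_norm v = Max (insert 0 {\<bar>v $ i\<bar> | i. i < dim_vec v})"

record iqp =
  cmat :: "int mat"
  rhs :: "real vec"
  quad :: "real vec"
  lin :: "real vec"

(* Coordinates are 0-based; k is the dimension of the vector quad of the q_i. *)
definition iqp_instance :: "nat \<Rightarrow> nat \<Rightarrow> iqp \<Rightarrow> bool" where
  "iqp_instance n k P \<longleftrightarrow>
     k \<le> n \<and>
     dim_col (cmat P) = n \<and>
     rhs P \<in> carrier_vec (dim_row (cmat P)) \<and>
     quad P \<in> carrier_vec k \<and> (\<forall>i<k. quad P $ i > 0) \<and>
     lin P \<in> carrier_vec n"

definition objective :: "iqp \<Rightarrow> real vec \<Rightarrow> real" where
  "objective P x = (\<Sum>i<dim_vec (quad P). - (quad P $ i) * (x $ i)\<^sup>2) + lin P \<bullet> x"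

(* On vectors, \<le> is the componentwise order and includes equality of dimensions. *)
definition qp_feasible :: "iqp \<Rightarrow> real vec set" where
  "qp_feasible P =
     {x \<in> carrier_vec (dim_col (cmat P)). map_mat real_of_int (cmat P) *\<^sub>v x \<le> rhs P}"

definition iqp_feasible :: "iqp \<Rightarrow> real vec set" where
  "iqp_feasible P = {x \<in> qp_feasible P. \<forall>i < dim_vec x. x $ i \<in> \<int>}"

definition optimal_solution :: "('a \<Rightarrow> real) \<Rightarrow> 'a set \<Rightarrow> 'a \<Rightarrow> bool" where
  "optimal_solution f S x \<longleftrightarrow> is_arg_min f (\<lambda>y. y \<in> S) x"

(* If f is bounded above on S without attaining a maximum, f_max does not exist and no point
   is an approximate solution. *)
definition approx_solution :: "('a \<Rightarrow> real) \<Rightarrow> 'a set \<Rightarrow> real \<Rightarrow> 'a \<Rightarrow> bool" where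
  "approx_solution f S \<epsilon> x \<longleftrightarrow>
     x \<in> S \<and>
     (\<exists>xopt. optimal_solution f S xopt \<and>
        ((\<exists>xmax. is_arg_max f (\<lambda>y. y \<in> S) xmax \<and>
            f x - f xopt \<le> \<epsilon> * (f xmax - f xopt)) \<or>
         (\<not> bdd_above (f ` S) \<and> \<epsilon> > 0)))"

definition proximity_distances :: "iqp \<Rightarrow> real \<Rightarrow> real set" where
  "proximity_distances P \<epsilon> = {linf_norm (xc - xs) | xc xs.
     approx_solution (objective P) (iqp_feasible P) \<epsilon> xs \<and>
     optimal_solution (objective P) (qp_feasible P) xc}"

(* A relation rather than a function, so that the existence of the minimum is asserted. *)
definition is_delta_star :: "iqp \<Rightarrow> real \<Rightarrow> real \<Rightarrow> bool" where
  "is_delta_star P \<epsilon> \<delta> \<longleftrightarrow>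
     \<delta> \<in> proximity_distances P \<epsilon> \<and> (\<forall>d \<in> proximity_distances P \<epsilon>. \<delta> \<le> d)"

end

theory Submission
  imports Defs
begin

text \<open>
  In dimension 2 let \<open>t = 1 - 1/(4\<Delta>)\<close> and consider the thin strip
  \<open>-1/2 \<le> x\<^sub>1 - \<Delta> x\<^sub>2 \<le> 0\<close>, \<open>-t \<le> x\<^sub>2 \<le> 1\<close>. Its only integer points are \<open>0\<close> and \<open>(\<Delta>, 1)\<close>.
  If the objective takes a smaller value at \<open>(\<Delta>, 1)\<close> than at \<open>0\<close>, then \<open>0\<close> is the maximizer of (IQP),
  so \<open>(\<Delta>, 1)\<close> is the only \<open>\<epsilon>\<close>-approximate solution for \<open>\<epsilon> < 1\<close>. The objective is chosen such that
  the unique optimum of (QP) is the opposite vertex \<open>(-\<Delta> - 1/4, -t)\<close>, and the first coordinates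
  of the two points differ by \<open>2\<Delta> + 1/4\<close>.
\<close>

section \<open>The strip instance and two-dimensional vectors\<close>

definition strip_mat :: "int \<Rightarrow> int mat" where
  "strip_mat D = mat_of_rows_list 2 [[1, - D], [- 1, D], [0, 1], [0, - 1]]"

text \<open>With \<open>t = 1 - 1/(4D)\<close>, the bound \<open>x2 >= -t\<close> cuts off the
  integer point \<open>(-D, -1)\<close>, yet since \<open>D * (1 - t) = 1/4 < 1/2\<close> the strip
  still reaches to the left of \<open>-D\<close>. The linear terms give the objective
  \<open>a * (D - a) + b * (1 - t - b)\<close>. Its first summand vanishes at both 0 and
  \<open>D\<close>. Its second is symmetric about the midpoint of \<open>[-t, 1]\<close>, with value
  \<open>-t\<close> at both ends, so the objective is 0 at the origin and \<open>-t < 0\<close> at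
  \<open>(D, 1)\<close>.\<close>

definition strip_iqp :: "int \<Rightarrow> iqp" where
  "strip_iqp D = \<lparr>cmat = strip_mat D,
     rhs = vec_of_list [0, 1/2, 1, 1 - 1 / (4 * real_of_int D)],
     quad = vec_of_list [1, 1],
     lin = vec_of_list [real_of_int D, 1 / (4 * real_of_int D)]\<rparr>"

definition vec2 :: "real \<Rightarrow> real \<Rightarrow> real vec" where
  "vec2 a b = vec_of_list [a, b]"

lemma vec2_simps [simp]:
  "dim_vec (vec2 a b) = 2" "vec2 a b $ 0 = a" "vec2 a b $ Suc 0 = b"
  by (simp_all add: vec2_def)

lemma vec2_eq_iff [simp]: "vec2 a b = vec2 c d \<longleftrightarrow> a = c \<and> b = d"
  by (metis vec2_simps(2,3))

lemma vec2_nth_eq: "dim_vec x = 2 \<Longrightarrow> vec2 (x $ 0) (x $ 1) = x"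
  by (intro eq_vecI) (auto simp: less_2_cases_iff)

lemma linf_norm_vec2_diff:
  "linf_norm (vec2 a b - vec2 c d) = max \<bar>a - c\<bar> \<bar>b - d\<bar>"
proof -
  have "{i. i < dim_vec (vec2 a b - vec2 c d)} = {0, Suc 0}"
    by (auto simp: less_2_cases_iff)
  then have "{\<bar>(vec2 a b - vec2 c d) $ i\<bar> | i. i < dim_vec (vec2 a b - vec2 c d)}
      = {\<bar>a - c\<bar>, \<bar>b - d\<bar>}"
    unfolding setcompr_eq_image by (simp only: image_insert image_empty) simp
  then show ?thesis
    unfolding linf_norm_def by simp
qed

section \<open>Subdeterminants of the strip matrix\<close>

lemma det_2x2:
  fixes A :: "'a :: comm_ring_1 mat"
  assumes A: "A \<in> carrier_mat 2 2"
  shows "det A = A $$ (0, 0) * A $$ (1, 1) - A $$ (0, 1) * A $$ (1, 0)"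
proof -
  have "det (mat_delete A i 0) = mat_delete A i 0 $$ (0, 0)" for i
    using A by (intro det_single carrier_matI) simp_all
  moreover have "mat_delete A 0 0 $$ (0, 0) = A $$ (1, 1)" "mat_delete A 1 0 $$ (0, 0) = A $$ (0, 1)"
    using A by (simp_all add: mat_delete_def)
  ultimately show ?thesis
    using laplace_expansion_column[OF A, of 0]
    by (simp add: cofactor_def numeral_2_eq_2 lessThan_Suc algebra_simps)
qed

lemma strip_mat_simps [simp]:
  "dim_row (strip_mat D) = 4" "dim_col (strip_mat D) = 2"
  "strip_mat D $$ (0, 0) = 1" "strip_mat D $$ (0, Suc 0) = - D"
  "strip_mat D $$ (Suc 0, 0) = - 1" "strip_mat D $$ (Suc 0, Suc 0) = D"
  "strip_mat D $$ (2, 0) = 0" "strip_mat D $$ (2, Suc 0) = 1"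
  "strip_mat D $$ (3, 0) = 0" "strip_mat D $$ (3, Suc 0) = - 1"
  by (simp_all add: strip_mat_def mat_of_rows_list_def)

lemma less_4_cases: "i < 4 \<longleftrightarrow> i = 0 \<or> i = Suc 0 \<or> i = 2 \<or> i = (3::nat)"
  by auto

text \<open>Minors of order one are entries, hence 0, 1, -1, \<open>D\<close> or \<open>-D\<close>.
  Up to sign the rows are \<open>(1, -D)\<close> and \<open>(0, 1)\<close>, whose determinant is 1,
  so every minor of order two is 0, 1 or -1.\<close>

lemma abs_det_submatrix_strip_mat_le:
  assumes D: "1 \<le> D"
    and I: "I \<subseteq> {..<4}" "I \<noteq> {}" and J: "J \<subseteq> {..<2}" and card: "card I = card J"
  shows "\<bar>det (submatrix (strip_mat D) I J)\<bar> \<le> D"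
proof -
  let ?S = "submatrix (strip_mat D) I J"
  have rows: "{i. i < dim_row (strip_mat D) \<and> i \<in> I} = I"
    and cols: "{j. j < dim_col (strip_mat D) \<and> j \<in> J} = J"
    using I J by auto
  have dims: "dim_row ?S = card I" "dim_col ?S = card I"
    by (simp_all only: dim_submatrix rows cols card)
  have entry: "?S $$ (i, j) = strip_mat D $$ (pick I i, pick J j)"
    if "i < card I" "j < card I" for i j
    using that rows cols card by (simp add: submatrix_index)
  have pickI: "pick I i < 4" if "i < card I" for i
    using pick_in_set_le[OF that] I(1) by auto
  have pickJ: "pick J j < 2" if "j < card I" for j
    using pick_in_set_le[of j J] that card J by auto
  have "finite I"
    using I(1) finite_subset by blast
  then have "card I \<noteq> 0"
    using I(2) by simp
  moreover have "card I \<le> 2"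
    using card_mono[OF _ J] card by simp
  ultimately consider "card I = 1" | "card I = 2"
    by linarith
  then show ?thesis
  proof cases
    case 1
    then have "det ?S = ?S $$ (0, 0)"
      using dims by (intro det_single carrier_matI) simp_all
    then have "det ?S = strip_mat D $$ (pick I 0, pick J 0)"
      using 1 entry by simp
    moreover have "\<bar>strip_mat D $$ (i, j)\<bar> \<le> D" if "i < 4" "j < 2" for i j
      using that D unfolding less_4_cases less_2_cases_iff by (elim disjE) simp_all
    ultimately show ?thesis
      using 1 pickI pickJ by simp
  next
    case 2
    have "det ?S = ?S $$ (0, 0) * ?S $$ (1, 1) - ?S $$ (0, 1) * ?S $$ (1, 0)"
      using dims 2 by (intro det_2x2 carrier_matI) simp_all
    \<comment> \<open>Two distinct column indices below 2 must be 0 and 1, in this order.\<close>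
    moreover have "pick J 0 < pick J 1"
      using pick_mono_le[of 1 J 0] 2 card by simp
    then have "pick J 0 = 0" "pick J 1 = 1"
      using pickJ[of 1] 2 by auto
    ultimately have "det ?S = strip_mat D $$ (pick I 0, 0) * strip_mat D $$ (pick I 1, 1)
        - strip_mat D $$ (pick I 0, 1) * strip_mat D $$ (pick I 1, 0)"
      using 2 entry by simp
    moreover have "\<bar>strip_mat D $$ (i, 0) * strip_mat D $$ (j, 1)
        - strip_mat D $$ (i, 1) * strip_mat D $$ (j, 0)\<bar> \<le> D" if "i < 4" "j < 4" for i j
      using that D unfolding less_4_cases by (elim disjE) simp_all
    ultimately show ?thesis
      using 2 pickI[of 0] pickI[of 1] by (simp del: pick.simps One_nat_def)
  qed
qed

lemma has_subdeterminant_strip_mat: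
  assumes "1 \<le> D"
  shows "has_subdeterminant (strip_mat D) D"
proof -
  \<comment> \<open>The bound is attained by the single entry \<open>-D\<close>.\<close>
  let ?S = "submatrix (strip_mat D) {0} {1}"
  have rows: "{i. i < dim_row (strip_mat D) \<and> i \<in> {0}} = {0}"
    and cols: "{j. j < dim_col (strip_mat D) \<and> j \<in> {1}} = {1}"
    by auto
  have "?S \<in> carrier_mat 1 1"
    by (rule carrier_matI) (simp_all only: dim_submatrix rows cols, simp_all)
  moreover have "pick {0} 0 = 0" "pick {1} 0 = 1"
    by (auto intro: Least_equality)
  then have "?S $$ (0, 0) = - D"
    by (subst submatrix_index) (simp_all only: rows cols, simp_all)
  ultimately have "det ?S = - D"
    by (simp add: det_single)
  moreover have "det ?S \<in> subdeterminants (strip_mat D)"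
    unfolding subdeterminants_def by (intro CollectI exI[of _ "{0}"] exI[of _ "{1}"]) simp
  ultimately have "D \<in> abs ` subdeterminants (strip_mat D)"
    using assms by (intro image_eqI[of _ _ "- D"]) simp_all
  then show ?thesis
    using abs_det_submatrix_strip_mat_le[OF assms]
    by (auto simp: has_subdeterminant_def subdeterminants_def)
qed

section \<open>Objective and feasible sets\<close>

lemma iqp_instance_strip: "iqp_instance 2 2 (strip_iqp D)"
  unfolding iqp_instance_def strip_iqp_def
  by (intro conjI carrier_vecI allI impI) (auto simp: less_2_cases_iff)

lemma objective_strip:
  "objective (strip_iqp D) (vec2 a b)
     = a * (real_of_int D - a) + b * (1 / (4 * real_of_int D) - b)"
  by (simp add: objective_def strip_iqp_def scalar_prod_def numeral_2_eq_2 lessThan_Suc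
      atLeast0LessThan algebra_simps power2_eq_square)

lemma vec2_mem_qp_feasible_strip:
  "vec2 a b \<in> qp_feasible (strip_iqp D) \<longleftrightarrow>
     a \<le> real_of_int D * b \<and> real_of_int D * b - 1/2 \<le> a \<and>
     b \<le> 1 \<and> - (1 - 1 / (4 * real_of_int D)) \<le> b"
proof -
  have row: "(map_mat real_of_int (strip_mat D) *\<^sub>v vec2 a b) $ i =
      real_of_int (strip_mat D $$ (i, 0)) * a + real_of_int (strip_mat D $$ (i, 1)) * b" if "i < 4" for i
    using that by (simp add: scalar_prod_def numeral_2_eq_2)
  have all: "(\<forall>i<4. P i) \<longleftrightarrow> P 0 \<and> P (Suc 0) \<and> P 2 \<and> P 3" for P :: "nat \<Rightarrow> bool"
    unfolding less_4_cases by blast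
  have cmat: "cmat (strip_iqp D) = strip_mat D" and dim_rhs: "dim_vec (rhs (strip_iqp D)) = 4"
    by (simp_all add: strip_iqp_def)
  have rhs: "rhs (strip_iqp D) $ i = [0, 1/2, 1, 1 - 1 / (4 * real_of_int D)] ! i" for i
    unfolding strip_iqp_def iqp.simps vec_of_list_index ..
  have "vec2 a b \<in> qp_feasible (strip_iqp D) \<longleftrightarrow> (\<forall>i<4.
      real_of_int (strip_mat D $$ (i, 0)) * a + real_of_int (strip_mat D $$ (i, 1)) * b
      \<le> [0, 1/2, 1, 1 - 1 / (4 * real_of_int D)] ! i)"
    unfolding qp_feasible_def less_eq_vec_def cmat dim_rhs
    using carrier_vecI[OF vec2_simps(1), of a b]
    by (simp add: row rhs del: index_mult_mat_vec cong: imp_cong)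
  then show ?thesis
    unfolding all by auto
qed

lemma qp_feasible_strip_obtains:
  assumes "x \<in> qp_feasible (strip_iqp D)"
  obtains a b where "x = vec2 a b"
  using assms vec2_nth_eq[of x] that[of "x $ 0" "x $ 1"] by (auto simp: qp_feasible_def strip_iqp_def)

text \<open>Since \<open>-t > -1\<close>, an integer \<open>x2\<close> is 0 or 1. The interval
  \<open>[D * x2 - 1/2, D * x2]\<close> is shorter than 1, so its only integer is
  \<open>D * x2\<close>.\<close>

lemma iqp_feasible_strip:
  assumes "1 \<le> D"
  shows "iqp_feasible (strip_iqp D) = {vec2 0 0, vec2 (real_of_int D) 1}" (is "_ = ?R")
proof
  have D: "0 < 1 / (4 * real_of_int D)" "1 / (4 * real_of_int D) \<le> 1"
    using assms by auto
  then show "?R \<subseteq> iqp_feasible (strip_iqp D)"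
    unfolding iqp_feasible_def mem_Collect_eq insert_subset vec2_mem_qp_feasible_strip
    by (intro conjI) (linarith | simp add: less_2_cases_iff)+
  show "iqp_feasible (strip_iqp D) \<subseteq> ?R"
  proof
    fix x assume x: "x \<in> iqp_feasible (strip_iqp D)"
    then have "x \<in> qp_feasible (strip_iqp D)"
      by (simp add: iqp_feasible_def)
    then obtain a b where ab: "x = vec2 a b"
      by (rule qp_feasible_strip_obtains)
    have feas: "vec2 a b \<in> qp_feasible (strip_iqp D)" and "a \<in> \<int>" "b \<in> \<int>"
      using x unfolding ab iqp_feasible_def by (auto dest: spec[of _ 0] spec[of _ "Suc 0"])
    then obtain i j where ij: "a = of_int i" "b = of_int j"
      by (auto elim!: Ints_cases)
    have "real_of_int j \<le> 1" "- 1 < real_of_int j"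
      using feas D unfolding vec2_mem_qp_feasible_strip ij by linarith+
    then have "j = 0 \<or> j = 1"
      by linarith
    moreover have "real_of_int i \<le> real_of_int (D * j)" "real_of_int (D * j) - 1/2 \<le> real_of_int i"
      using feas unfolding vec2_mem_qp_feasible_strip ij by auto
    then have "i = D * j"
      by linarith
    ultimately show "x \<in> ?R"
      by (auto simp: ab ij)
  qed
qed

section \<open>The unique optimum of (QP)\<close>

lemma optimal_solution_qp_strip_iff:
  assumes "1 \<le> D"
  shows "optimal_solution (objective (strip_iqp D)) (qp_feasible (strip_iqp D)) x \<longleftrightarrow>
    x = vec2 (- real_of_int D - 1/4) (- (1 - 1 / (4 * real_of_int D)))"
proof -
  define d where "d = real_of_int D"
  define t where "t = 1 - 1 / (4 * d)"
  define v where "v = vec2 (- d - 1/4) (- t)"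
  let ?f = "objective (strip_iqp D)" and ?S = "qp_feasible (strip_iqp D)"
  have d: "1 \<le> d" and dt: "d * t = d - 1/4" and t: "0 \<le> t"
    using assms by (auto simp: d_def t_def field_simps)
  have v: "v \<in> ?S"
    unfolding v_def vec2_mem_qp_feasible_strip d_def[symmetric] t_def[symmetric] using t dt by auto
  \<comment> \<open>The last two bounds enclose the feasible set in the box
    \<open>[-d - 1/4, d] x [-t, 1]\<close>, which has \<open>v\<close> as a corner; the left end is
    \<open>-d * t - 1/2\<close>.\<close>
  have feas: "a \<le> d * b" "d * b - 1/2 \<le> a" "b \<le> 1" "- t \<le> b" "- d - 1/4 \<le> a" "a \<le> d"
    if "vec2 a b \<in> ?S" for a b
  proof -
    show ab: "a \<le> d * b" "d * b - 1/2 \<le> a" "b \<le> 1" "- t \<le> b"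
      using that unfolding vec2_mem_qp_feasible_strip d_def t_def by auto
    have "d * - t \<le> d * b" "d * b \<le> d * 1"
      using ab d by (intro mult_left_mono; simp)+
    then show "- d - 1/4 \<le> a" "a \<le> d"
      using ab dt by linarith+
  qed
  \<comment> \<open>The objective is separable, and in each variable the difference to its value at
    \<open>v\<close> is a quadratic with the coordinate of \<open>v\<close> as a root. On the box
    all four factors are nonnegative.\<close>
  have diff: "?f (vec2 a b) - ?f v = (a + (d + 1/4)) * (d + (d + 1/4) - a) + (b + t) * (1 - b)" for a b
  proof -
    have "1 / (4 * d) = 1 - t"
      by (simp add: t_def)
    then show ?thesis
      unfolding v_def objective_strip d_def[symmetric] by (simp only:) (simp add: algebra_simps)
  qed
  have nonneg: "0 \<le> (a + (d + 1/4)) * (d + (d + 1/4) - a)" "0 \<le> (b + t) * (1 - b)"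
    if "vec2 a b \<in> ?S" for a b
    using feas[OF that] d by (intro mult_nonneg_nonneg; linarith)+
  have min: "?f v \<le> ?f y" if y: "y \<in> ?S" for y
  proof -
    obtain a b where y_eq: "y = vec2 a b"
      using qp_feasible_strip_obtains[OF y] .
    show ?thesis
      using diff[of a b] nonneg[of a b] y unfolding y_eq by linarith
  qed
  have unique: "y = v" if y: "y \<in> ?S" and le: "?f y \<le> ?f v" for y
  proof -
    obtain a b where y_eq: "y = vec2 a b"
      using qp_feasible_strip_obtains[OF y] .
    note ab = feas[OF y[unfolded y_eq]]
    have "(a + (d + 1/4)) * (d + (d + 1/4) - a) = 0"
      using diff[of a b] nonneg[OF y[unfolded y_eq]] le unfolding y_eq by linarith
    \<comment> \<open>The other root, \<open>2 * d + 1/4\<close>, exceeds the bound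
      \<open>a \<le> d\<close>.\<close>
    then have a: "a = - d - 1/4"
      using ab d by auto
    \<comment> \<open>The product \<open>(b + t) * (1 - b)\<close> also vanishes at
      \<open>b = 1\<close>, so \<open>b\<close> is determined from the strip inequality
      \<open>d * b - 1/2 \<le> a\<close> instead.\<close>
    then have "d * b \<le> d * - t"
      using ab dt by simp
    then have "b \<le> - t"
      using d by (subst (asm) mult_le_cancel_left_pos) simp_all
    then have "b = - t"
      using ab by simp
    with a show ?thesis
      by (simp add: y_eq v_def)
  qed
  have "optimal_solution ?f ?S x \<longleftrightarrow> x = v"
    unfolding optimal_solution_def is_arg_min_linorder using v min unique by blast
  then show ?thesis
    by (simp add: v_def t_def d_def)
qed

section \<open>Approximate solutions of (IQP) and the proximity distance\<close>

lemma optimal_solution_iqp_strip: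
  assumes "1 \<le> D"
  shows "optimal_solution (objective (strip_iqp D)) (iqp_feasible (strip_iqp D)) (vec2 (real_of_int D) 1)"
  using assms
  by (auto simp: optimal_solution_def is_arg_min_linorder iqp_feasible_strip objective_strip field_simps)

text \<open>If a problem has just two values, the larger one is \<open>f\<^sub>m\<^sub>a\<^sub>x\<close> and has relative error 1.\<close>

lemma approx_solution_two_points_iff:
  assumes S: "S = {p, q}" and less: "f p < f q" and \<epsilon>: "0 < \<epsilon>" "\<epsilon> < 1"
  shows "approx_solution f S \<epsilon> x \<longleftrightarrow> x = p"
proof
  have opt: "optimal_solution f S y \<longleftrightarrow> y = p" for y
    using less by (auto simp: S optimal_solution_def is_arg_min_linorder)
  have max: "is_arg_max f (\<lambda>y. y \<in> S) y \<longleftrightarrow> y = q" for y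
    using less by (auto simp: S is_arg_max_linorder)
  \<comment> \<open>This excludes the unbounded case of \<open>approx_solution\<close>, which would
    accept every feasible point.\<close>
  have bdd: "bdd_above (f ` S)"
    by (simp add: S)
  show "approx_solution f S \<epsilon> x \<Longrightarrow> x = p"
  proof (rule ccontr)
    assume x: "approx_solution f S \<epsilon> x" and "x \<noteq> p"
    then have "f q - f p \<le> \<epsilon> * (f q - f p)"
      by (auto simp: approx_solution_def opt max bdd) (auto simp: S)
    then show False
      using less \<epsilon> by simp
  qed
  show "x = p \<Longrightarrow> approx_solution f S \<epsilon> x"
    using less \<epsilon> by (auto simp: approx_solution_def opt max bdd) (auto simp: S)
qed

text \<open>Both the approximate solution and the continuous optimum are unique, so there is only
  one distance to compute.\<close>

lemma proximity_distances_strip: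
  assumes D: "1 \<le> D" and \<epsilon>: "0 < \<epsilon>" "\<epsilon> < 1"
  shows "proximity_distances (strip_iqp D) \<epsilon> = {2 * real_of_int D + 1/4}"
proof -
  have "approx_solution (objective (strip_iqp D)) (iqp_feasible (strip_iqp D)) \<epsilon> x
    \<longleftrightarrow> x = vec2 (real_of_int D) 1" for x
    using D by (intro approx_solution_two_points_iff[OF _ _ \<epsilon>, where q = "vec2 0 0"])
      (auto simp: iqp_feasible_strip objective_strip field_simps)
  moreover have "linf_norm (vec2 (- real_of_int D - 1/4) (- (1 - 1 / (4 * real_of_int D)))
      - vec2 (real_of_int D) 1) = 2 * real_of_int D + 1/4"
  proof -
    \<comment> \<open>The second coordinates differ by \<open>1 + t < 2\<close>, so the first
      coordinate decides the norm.\<close>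
    have "0 < 1 / (4 * real_of_int D)" "1 / (4 * real_of_int D) \<le> 1" "1 \<le> real_of_int D"
      using D by auto
    then show ?thesis
      unfolding linf_norm_vec2_diff by linarith
  qed
  ultimately show ?thesis
    unfolding proximity_distances_def optimal_solution_qp_strip_iff[OF D] by simp
qed

theorem proposition2:
  fixes \<Delta> :: int and \<epsilon> :: real
  assumes "\<Delta> \<ge> 1" and "0 < \<epsilon>" and "\<epsilon> < 1"
  shows "\<exists>n k P \<delta>.
           iqp_instance n k P \<and> k = n \<and>
           has_subdeterminant (cmat P) \<Delta> \<and>
           (\<exists>x. optimal_solution (objective P) (iqp_feasible P) x) \<and>
           (\<exists>x. optimal_solution (objective P) (qp_feasible P) x) \<and>
           is_delta_star P \<epsilon> \<delta> \<and>
           \<delta> > real n * real_of_int \<Delta>"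
proof (intro exI conjI)
  show "iqp_instance 2 2 (strip_iqp \<Delta>)"
    by (rule iqp_instance_strip)
  show "has_subdeterminant (cmat (strip_iqp \<Delta>)) \<Delta>"
    using has_subdeterminant_strip_mat[OF assms(1)] by (simp add: strip_iqp_def)
  show "optimal_solution (objective (strip_iqp \<Delta>)) (iqp_feasible (strip_iqp \<Delta>)) (vec2 (real_of_int \<Delta>) 1)"
    using assms(1) by (rule optimal_solution_iqp_strip)
  show "optimal_solution (objective (strip_iqp \<Delta>)) (qp_feasible (strip_iqp \<Delta>))
      (vec2 (- real_of_int \<Delta> - 1/4) (- (1 - 1 / (4 * real_of_int \<Delta>))))"
    using optimal_solution_qp_strip_iff[OF assms(1)] by blast
  show "is_delta_star (strip_iqp \<Delta>) \<epsilon> (2 * real_of_int \<Delta> + 1/4)"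
    using proximity_distances_strip[OF assms] by (simp add: is_delta_star_def)
qed simp_all

end
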